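(* Let the iterative algorithm given by $A:\mathbb{R}^{Nd}\times\mathcal{X}\to\mathcal{X}$ and $C=(C_1,\ldots,C_N):\mathcal{X}\to\mathbb{R}^{Nd}$ be $\sigma$-linear convergent in the norm $\|\cdot\|$ with $\sigma\in(0,1)$, point $\mathbf{x}^\star$ and constants $L_A>0$, $L_C\ge 0$ (as defined in the context). Let $b\ge 1$ be an integer and consider the $b$-bit quantized algorithm described in the context, started at $\mathbf{x}^0\in\mathcal{X}$. Let $D>0$ be such that either (i) $\|\mathbf{x}^1-\mathbf{x}^0\|\le(1-\sigma)D$, or (ii) $\|\mathbf{x}^0-\mathbf{x}^\star\|\le D$. Set $$r^k=\frac{K}{L_A}\,\alpha(b)^{k+1}D,\qquad \alpha(b)=\frac{K}{2^b-1}+\sigma,\qquad K=\max\left\{1,\frac{2L_AL_C}{\sigma}\right\},$$ and assume $\alpha(b)<1$. Then $$\|\mathbf{x}^k-\mathbf{x}^\star\|\le\alpha(b)^kD\quad\text{for all }k\in\mathbb{N}.$$ Moreover, for any $\epsilon>0$, $$\|\mathbf{x}^k-\mathbf{x}^\star\|\le\epsilon\quad\text{for all integers } k\ge k_\epsilon(b):=\frac{1}{1-\alpha(b)}\log\left(\frac{D}{\epsilon}\right).$$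
   Context: $\mathbb{N}=\{0,1,2,\ldots\}$; $\log$ is the natural logarithm; $N,d\ge1$ are integers; $\|\cdot\|_\infty$ is the max-norm. $\mathcal{X}$ is a subset of a finite-dimensional Euclidean space and $\|\cdot\|$ is a norm (on the linear span of $\mathcal{X}$). Unquantized algorithm: $\mathbf{x}^{k+1}=A(\mathbf{c}^k,\mathbf{x}^k)$, $\mathbf{c}_i^{k+1}=C_i(\mathbf{x}^{k+1})$ for $i=1,\ldots,N$, where $\mathbf{c}^k=(\mathbf{c}^k_1,\ldots,\mathbf{c}^k_N)$, $A:\mathbb{R}^{Nd}\times\mathcal{X}\to\mathcal{X}$, $C_i:\mathcal{X}\to\mathbb{R}^d$, and $C(\mathbf{x})=(C_1(\mathbf{x}),\ldots,C_N(\mathbf{x}))$. $\sigma$-linear convergent in the norm $\|\cdot\|$: (a) there is $\mathbf{x}^\star\in\mathcal{X}$ with $\|A(C(\mathbf{x}),\mathbf{x})-\mathbf{x}^\star\|\le\sigma\|\mathbf{x}-\mathbf{x}^\star\|$ for all $\mathbf{x}\in\mathcal{X}$; (b) there are constants $L_A,L_C$ such that $\|A(\mathbf{c}_1,\mathbf{x})-A(\mathbf{c}_2,\mathbf{x})\|\le L_A\|\mathbf{c}_1-\mathbf{c}_2\|_\infty$ and $\|C(\mathbf{x}_1)-C(\mathbf{x}_2)\|_\infty\le L_C\|\mathbf{x}_1-\mathbf{x}_2\|$ for all $\mathbf{x},\mathbf{x}_1,\mathbf{x}_2\in\mathcal{X}$, $\mathbf{c}_1,\mathbf{c}_2\in\mathbb{R}^{Nd}$.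 Quantization function $\mathrm{quant}:\mathbb{R}^d\times\mathbb{R}^d\times\mathbb{R}_+\times\mathbb{N}\to\mathbb{R}^d$, defined componentwise with $\delta=r/(2^b-1)$ (first applicable case): $$[\mathrm{quant}(\mathbf{c},\mathbf{q},r,b)]_j=\begin{cases}\mathbf{q}_j-r&\text{if }\mathbf{c}_j\le\mathbf{q}_j-r+\delta,\\ \mathbf{q}_j+r&\text{if }\mathbf{c}_j\ge\mathbf{q}_j+r-\delta,\\ \mathbf{q}_j-r+2\delta\left\lfloor\frac{\mathbf{c}_j-\mathbf{q}_j+r+\delta}{2\delta}\right\rfloor&\text{otherwise.}\end{cases}$$ $b$-bit quantized algorithm: given $\mathbf{x}^0\in\mathcal{X}$, set $\mathbf{q}_i^0=\mathbf{c}_i^0=C_i(\mathbf{x}^0)$, and for $k\in\mathbb{N}$, with $\mathbf{q}^k=(\mathbf{q}^k_1,\ldots,\mathbf{q}^k_N)$, $$\mathbf{x}^{k+1}=A(\mathbf{q}^k,\mathbf{x}^k),\quad \mathbf{c}_i^{k+1}=C_i(\mathbf{x}^{k+1}),\quad \mathbf{q}_i^{k+1}=\mathrm{quant}(\mathbf{c}_i^{k+1},\mathbf{q}_i^k,r^k,b),\quad i=1,\ldots,N.$$ *)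

theory Defs
  imports "HOL-Analysis.Analysis"
begin

definition is_norm_on :: "'a::real_vector set \<Rightarrow> ('a \<Rightarrow> real) \<Rightarrow> bool" where
  "is_norm_on V nrm \<longleftrightarrow>
     (\<forall>x\<in>V. 0 \<le> nrm x) \<and>
     (\<forall>x\<in>V. nrm x = 0 \<longleftrightarrow> x = 0) \<and>
     (\<forall>a. \<forall>x\<in>V. nrm (a *\<^sub>R x) = \<bar>a\<bar> * nrm x) \<and>
     (\<forall>x\<in>V. \<forall>y\<in>V. nrm (x + y) \<le> nrm x + nrm y)"

text \<open>
  The space of \<open>N\<close>-tuples of vectors in dimension \<open>d\<close> is \<open>real ^ 'd ^ 'n\<close>, with \<open>CARD('n) = N\<close> and
  \<open>CARD('d) = d\<close>; the \<open>i\<close>-th block of \<open>c\<close> is \<open>c $ i\<close>. The standard basis of this type consists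
  of the unit vectors of the individual real components, so \<^const>\<open>infnorm\<close> is the max-norm
  over all \<open>Nd\<close> components.

  The functions \<open>A\<close> and \<open>C\<close> are only constrained for states in \<open>X\<close>.
\<close>

definition linear_convergent ::
  "'a::euclidean_space set \<Rightarrow> ('a \<Rightarrow> real) \<Rightarrow> (real ^ 'd ^ 'n \<Rightarrow> 'a \<Rightarrow> 'a) \<Rightarrow> ('a \<Rightarrow> real ^ 'd ^ 'n)
   \<Rightarrow> real \<Rightarrow> 'a \<Rightarrow> real \<Rightarrow> real \<Rightarrow> bool" where
  "linear_convergent X nrm A C \<sigma> xstar L\<^sub>A L\<^sub>C \<longleftrightarrow>
     xstar \<in> X \<and>
     (\<forall>x\<in>X. nrm (A (C x) x - xstar) \<le> \<sigma> * nrm (x - xstar)) \<and>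
     (\<forall>x\<in>X. \<forall>c1 c2. nrm (A c1 x - A c2 x) \<le> L\<^sub>A * infnorm (c1 - c2)) \<and>
     (\<forall>x1\<in>X. \<forall>x2\<in>X. infnorm (C x1 - C x2) \<le> L\<^sub>C * nrm (x1 - x2))"

definition quant :: "real ^ 'd \<Rightarrow> real ^ 'd \<Rightarrow> real \<Rightarrow> nat \<Rightarrow> real ^ 'd" where
  "quant c q r b =
     (let \<delta> = r / (2 ^ b - 1) in
      \<chi> j. if c $ j \<le> q $ j - r + \<delta> then q $ j - r
           else if c $ j \<ge> q $ j + r - \<delta> then q $ j + r
           else q $ j - r + 2 * \<delta> * of_int \<lfloor>(c $ j - q $ j + r + \<delta>) / (2 * \<delta>)\<rfloor>)"

definition quantized_run ::
  "(real ^ 'd ^ 'n \<Rightarrow> 'a \<Rightarrow> 'a) \<Rightarrow> ('a \<Rightarrow> real ^ 'd ^ 'n) \<Rightarrow> nat \<Rightarrow> (nat \<Rightarrow> real) \<Rightarrow> 'a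
   \<Rightarrow> (nat \<Rightarrow> 'a) \<Rightarrow> (nat \<Rightarrow> real ^ 'd ^ 'n) \<Rightarrow> (nat \<Rightarrow> real ^ 'd ^ 'n) \<Rightarrow> bool" where
  "quantized_run A C b r x0 x c q \<longleftrightarrow>
     x 0 = x0 \<and> c 0 = C x0 \<and> q 0 = c 0 \<and>
     (\<forall>k. x (Suc k) = A (q k) (x k) \<and>
          c (Suc k) = C (x (Suc k)) \<and>
          (\<forall>i. q (Suc k) $ i = quant (c (Suc k) $ i) (q k $ i) (r k) b))"

end

theory Submission
  imports Defs
begin

text \<open>
  The argument is an induction on \<open>k\<close> that carries two bounds at once: the state error
  \<open>nrm (x k - xstar) \<le> \<alpha> ^ k * D\<close> and the quantization error
  \<open>infnorm (q k - c k) \<le> (\<alpha> - \<sigma>) / L\<^sub>A * \<alpha> ^ k * D\<close>.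

  One step of the perturbed iteration costs a factor \<open>\<sigma>\<close> by contraction plus \<open>L\<^sub>A\<close> times the
  quantization error, so the two bounds add up to \<open>(\<sigma> + (\<alpha> - \<sigma>)) * \<alpha> ^ k * D\<close>: this is why
  the state error decays at the rate \<open>\<alpha>\<close>. For the quantization error, the grid with \<open>b\<close> bits on a box
  of radius \<open>r\<close> has covering radius \<open>r / (2 ^ b - 1)\<close> (lemma \<open>abs_quant_diff_le\<close>), and with the
  chosen \<open>r k\<close> this is exactly the bound required at \<open>k + 1\<close>. What must be checked is that
  the new value \<open>c (Suc k)\<close> does lie in the box of radius \<open>r k\<close> around \<open>q k\<close>. Its distance to \<open>q k\<close> is
  at most the old quantization error plus \<open>L\<^sub>C\<close> times the distance between two consecutive states,
  each of which is already known to be close to \<open>xstar\<close>; the constant \<open>K\<close> is chosen to make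
  this sum fit into \<open>r k\<close> (lemma \<open>quantization_range_suffices\<close>).

  The first alternative for \<open>D\<close> implies the second, because the first iteration is exact and a
  contraction moves a point by at least \<open>1 - \<sigma>\<close> times its distance from the fixed point. The iteration
  count follows from \<open>\<alpha> \<le> exp (\<alpha> - 1)\<close>.
\<close>

section \<open>Norms on a subspace and the maximum norm\<close>

lemma is_norm_on_triangle:
  assumes "is_norm_on V nrm" and "u - v \<in> V" and "v - w \<in> V"
  shows "nrm (u - w) \<le> nrm (u - v) + nrm (v - w)"
proof -
  have "nrm ((u - v) + (v - w)) \<le> nrm (u - v) + nrm (v - w)"
    using assms unfolding is_norm_on_def by blast
  then show ?thesis by simp
qed

lemma is_norm_on_minus_commute:
  assumes "is_norm_on V nrm" and "u - v \<in> V"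
  shows "nrm (v - u) = nrm (u - v)"
proof -
  have "nrm ((-1) *\<^sub>R (u - v)) = \<bar>-1\<bar> * nrm (u - v)"
    using assms unfolding is_norm_on_def by blast
  then show ?thesis by simp
qed

lemma infnorm_le_iff_components:
  fixes z :: "real ^ 'd::finite ^ 'n::finite"
  shows "infnorm z \<le> B \<longleftrightarrow> (\<forall>i j. \<bar>z $ i $ j\<bar> \<le> B)"
  by (simp add: infnorm_Max Basis_vec_def inner_axis)

section \<open>The quantizer\<close>

text \<open>
  The grid points have spacing \<open>2 * \<delta>\<close> with \<open>\<delta> = r / (2 ^ b - 1)\<close>, and \<open>quant\<close> rounds to the nearest
  one. The extreme cases of the definition do not spoil this: a component that lies in the box and
  within \<open>\<delta>\<close> of its boundary is within \<open>\<delta>\<close> of the end point it is sent to.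
\<close>

lemma abs_quant_diff_le:
  fixes c q :: "real ^ 'd"
  assumes r: "0 < r" and b: "1 \<le> b" and box: "\<bar>c $ j - q $ j\<bar> \<le> r"
  shows "\<bar>quant c q r b $ j - c $ j\<bar> \<le> r / (2 ^ b - 1)"
proof -
  define \<delta> where "\<delta> = r / (2 ^ b - 1)"
  have "(2::real) ^ b \<ge> 2 ^ 1"
    using b by (intro power_increasing) auto
  then have \<delta>: "0 < \<delta>"
    using r by (simp add: \<delta>_def)
  define t where "t = (c $ j - q $ j + r + \<delta>) / (2 * \<delta>)"
  have t: "2 * \<delta> * t = c $ j - q $ j + r + \<delta>"
    using \<delta> by (simp add: t_def)
  have lower: "2 * \<delta> * of_int \<lfloor>t\<rfloor> \<le> 2 * \<delta> * t"
    using \<delta> by (intro mult_left_mono) auto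
  have "2 * \<delta> * t \<le> 2 * \<delta> * (of_int \<lfloor>t\<rfloor> + 1)"
    using \<delta> by (intro mult_left_mono) linarith+
  then have upper: "2 * \<delta> * t \<le> 2 * \<delta> * of_int \<lfloor>t\<rfloor> + 2 * \<delta>"
    by (simp add: algebra_simps)
  have "quant c q r b $ j =
      (if c $ j \<le> q $ j - r + \<delta> then q $ j - r
       else if c $ j \<ge> q $ j + r - \<delta> then q $ j + r
       else q $ j - r + 2 * \<delta> * of_int \<lfloor>t\<rfloor>)"
    by (simp add: quant_def Let_def \<delta>_def t_def)
  then have "\<bar>quant c q r b $ j - c $ j\<bar> \<le> \<delta>"
    using box \<delta> lower upper t by (auto split: if_splits)
  then show ?thesis by (simp add: \<delta>_def)
qed

section \<open>Constants and rates\<close>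

text \<open>
  With \<open>a\<close> for \<open>\<alpha>\<close>, the common factor \<open>a ^ k * D / L\<^sub>A\<close> removed and \<open>P = L\<^sub>A * L\<^sub>C\<close>, the left-hand side
  bounds the distance from \<open>c (Suc k)\<close> to \<open>q k\<close>, and the right-hand side is \<open>r k\<close>. The term
  \<open>K * \<sigma>\<close> of \<open>K * a = K * \<sigma> + K * (a - \<sigma>)\<close> pays for the movement of the state, using
  \<open>1 + a \<le> 2\<close>; the term \<open>K * (a - \<sigma>)\<close> pays for the old quantization error, using \<open>1 \<le> K\<close>.
\<close>

lemma quantization_range_suffices:
  fixes P K a \<sigma> :: real
  assumes "0 \<le> P" and "2 * P \<le> K * \<sigma>" and "1 \<le> K" and "\<sigma> \<le> a" and "a \<le> 1"
  shows "P * (1 + a) + (a - \<sigma>) \<le> K * a"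
proof -
  have "P * (1 + a) \<le> P * 2"
    using assms by (intro mult_left_mono) auto
  moreover have "1 * (a - \<sigma>) \<le> K * (a - \<sigma>)"
    using assms by (intro mult_right_mono) auto
  ultimately show ?thesis
    using assms(2) by (simp add: algebra_simps)
qed

lemma geometric_decay_le:
  fixes a D \<epsilon> :: real
  assumes "0 \<le> a" and "a < 1" and "0 < D" and "0 < \<epsilon>"
    and k: "1 / (1 - a) * ln (D / \<epsilon>) \<le> real k"
  shows "a ^ k * D \<le> \<epsilon>"
proof -
  have "a \<le> exp (a - 1)"
    using exp_ge_add_one_self[of "a - 1"] by simp
  then have "a ^ k \<le> exp (a - 1) ^ k"
    using assms by (intro power_mono) auto
  also have "\<dots> = exp (- (real k * (1 - a)))"
    by (simp add: algebra_simps flip: exp_of_nat_mult)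
  also have "\<dots> \<le> exp (- ln (D / \<epsilon>))"
    using k assms by (simp add: field_simps)
  also have "\<dots> = \<epsilon> / D"
    using assms by (simp add: exp_minus)
  finally show ?thesis
    using assms by (simp add: field_simps)
qed

section \<open>One step of the quantized iteration\<close>

lemma perturbed_step_error:
  fixes A :: "real ^ 'd::finite ^ 'n::finite \<Rightarrow> 'a::euclidean_space \<Rightarrow> 'a"
  assumes nrm: "is_norm_on (span X) nrm"
    and inv: "\<And>u y. y \<in> X \<Longrightarrow> A u y \<in> X"
    and conv: "linear_convergent X nrm A C \<sigma> xstar L\<^sub>A L\<^sub>C"
    and y: "y \<in> X"
  shows "nrm (A u y - xstar) \<le> L\<^sub>A * infnorm (u - C y) + \<sigma> * nrm (y - xstar)"
proof -
  have "xstar \<in> X"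
    using conv by (simp add: linear_convergent_def)
  then have "nrm (A u y - xstar) \<le> nrm (A u y - A (C y) y) + nrm (A (C y) y - xstar)"
    using y inv by (intro is_norm_on_triangle[OF nrm] span_diff) (auto intro: span_base)
  also have "\<dots> \<le> L\<^sub>A * infnorm (u - C y) + \<sigma> * nrm (y - xstar)"
    using conv y by (intro add_mono) (auto simp: linear_convergent_def)
  finally show ?thesis .
qed

text \<open>
  The distance to the fixed point is controlled by the length of one exact step, since
  the contraction leaves at most the fraction \<open>\<sigma>\<close> of that distance after the step.
\<close>

lemma dist_fixpoint_le_of_exact_step:
  fixes A :: "real ^ 'd::finite ^ 'n::finite \<Rightarrow> 'a::euclidean_space \<Rightarrow> 'a"
  assumes nrm: "is_norm_on (span X) nrm"
    and inv: "\<And>u y. y \<in> X \<Longrightarrow> A u y \<in> X"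
    and conv: "linear_convergent X nrm A C \<sigma> xstar L\<^sub>A L\<^sub>C"
    and y: "y \<in> X" and "\<sigma> < 1"
    and step: "nrm (A (C y) y - y) \<le> (1 - \<sigma>) * D"
  shows "nrm (y - xstar) \<le> D"
proof -
  have X: "xstar \<in> X" "A (C y) y \<in> X"
    using conv inv y by (simp_all add: linear_convergent_def)
  have "nrm (y - xstar) \<le> nrm (y - A (C y) y) + nrm (A (C y) y - xstar)"
    using y X by (intro is_norm_on_triangle[OF nrm] span_diff) (auto intro: span_base)
  also have "nrm (y - A (C y) y) = nrm (A (C y) y - y)"
    using y X by (intro is_norm_on_minus_commute[OF nrm] span_diff) (auto intro: span_base)
  also have "nrm (A (C y) y - xstar) \<le> \<sigma> * nrm (y - xstar)"
    using conv y by (simp add: linear_convergent_def)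
  finally have "(1 - \<sigma>) * nrm (y - xstar) \<le> (1 - \<sigma>) * D"
    using step by (simp add: algebra_simps)
  then show ?thesis
    using \<open>\<sigma> < 1\<close> by simp
qed

lemma output_change_le:
  fixes C :: "'a::euclidean_space \<Rightarrow> real ^ 'd::finite ^ 'n::finite"
  assumes nrm: "is_norm_on (span X) nrm"
    and conv: "linear_convergent X nrm A C \<sigma> xstar L\<^sub>A L\<^sub>C"
    and "0 \<le> L\<^sub>C" and y: "y \<in> X" and z: "z \<in> X"
  shows "infnorm (C z - C y) \<le> L\<^sub>C * (nrm (z - xstar) + nrm (y - xstar))"
proof -
  have X: "xstar \<in> X"
    using conv by (simp add: linear_convergent_def)
  have "nrm (z - y) \<le> nrm (z - xstar) + nrm (xstar - y)"
    using y z X by (intro is_norm_on_triangle[OF nrm] span_diff) (auto intro: span_base)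
  also have "nrm (xstar - y) = nrm (y - xstar)"
    using y X by (intro is_norm_on_minus_commute[OF nrm] span_diff) (auto intro: span_base)
  finally have "L\<^sub>C * nrm (z - y) \<le> L\<^sub>C * (nrm (z - xstar) + nrm (y - xstar))"
    using \<open>0 \<le> L\<^sub>C\<close> by (intro mult_left_mono) auto
  moreover have "infnorm (C z - C y) \<le> L\<^sub>C * nrm (z - y)"
    using conv y z by (simp add: linear_convergent_def)
  ultimately show ?thesis by linarith
qed

section \<open>Convergence of the quantized algorithm\<close>

theorem theorem1:
  fixes X :: "'a::euclidean_space set"
    and nrm :: "'a \<Rightarrow> real"
    and A :: "real ^ 'd::finite ^ 'n::finite \<Rightarrow> 'a \<Rightarrow> 'a"
    and C :: "'a \<Rightarrow> real ^ 'd ^ 'n"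
    and \<sigma> L\<^sub>A L\<^sub>C K \<alpha> D :: real
    and xstar x0 :: 'a
    and b :: nat
    and r :: "nat \<Rightarrow> real"
    and x :: "nat \<Rightarrow> 'a"
    and c q :: "nat \<Rightarrow> real ^ 'd ^ 'n"
  assumes "is_norm_on (span X) nrm"
    and "\<And>u y. y \<in> X \<Longrightarrow> A u y \<in> X"
    and "0 < \<sigma>" and "\<sigma> < 1" and "0 < L\<^sub>A" and "0 \<le> L\<^sub>C"
    and "linear_convergent X nrm A C \<sigma> xstar L\<^sub>A L\<^sub>C"
    and "1 \<le> b"
    and "x0 \<in> X"
    and "quantized_run A C b r x0 x c q"
    and "0 < D"
    and "nrm (x 1 - x 0) \<le> (1 - \<sigma>) * D \<or> nrm (x 0 - xstar) \<le> D"
    and "K = max 1 (2 * L\<^sub>A * L\<^sub>C / \<sigma>)"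
    and "\<alpha> = K / (2 ^ b - 1) + \<sigma>"
    and "\<And>k. r k = K / L\<^sub>A * \<alpha> ^ (k + 1) * D"
    and "\<alpha> < 1"
  shows "(\<forall>k. nrm (x k - xstar) \<le> \<alpha> ^ k * D) \<and>
         (\<forall>\<epsilon>>0. \<forall>k::nat. real k \<ge> 1 / (1 - \<alpha>) * ln (D / \<epsilon>) \<longrightarrow> nrm (x k - xstar) \<le> \<epsilon>)"
proof -
  note nrm = assms(1) and inv = assms(2) and conv = assms(7) and K = assms(13) and \<alpha> = assms(14)
  have x0: "x 0 = x0" and c0: "c 0 = C x0" and q0: "q 0 = c 0"
    and xS: "x (Suc k) = A (q k) (x k)" and cS: "c (Suc k) = C (x (Suc k))"
    and qS: "q (Suc k) $ i = quant (c (Suc k) $ i) (q k $ i) (r k) b" for k i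
    using assms(10) by (auto simp: quantized_run_def)
  have xX: "x k \<in> X" for k
    by (induction k) (use inv xS x0 assms(9) in auto)
  have c: "c k = C (x k)" for k
    using c0 cS x0 by (cases k) auto
  have "(2::real) ^ b \<ge> 2 ^ 1"
    using assms(8) by (intro power_increasing) auto
  then have levels: "(0::real) < 2 ^ b - 1" by simp
  have K1: "1 \<le> K" and "2 * L\<^sub>A * L\<^sub>C / \<sigma> \<le> K"
    by (simp_all add: K)
  then have KP: "2 * (L\<^sub>A * L\<^sub>C) \<le> K * \<sigma>"
    using assms(3) by (simp add: field_simps)
  have \<alpha>\<sigma>: "\<sigma> \<le> \<alpha>"
    using levels K1 by (simp add: \<alpha>)
  then have \<alpha>0: "0 < \<alpha>" using assms(3) by linarith
  have rpos: "0 < r k" for k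
    using assms(5,11,15) K1 \<alpha>0 by simp
  \<comment> \<open>The radii are chosen so that the resolution of step \<open>k\<close> is the error bound needed at \<open>k + 1\<close>.\<close>
  have r_res: "r k / (2 ^ b - 1) = (\<alpha> - \<sigma>) / L\<^sub>A * \<alpha> ^ Suc k * D" for k
    by (simp add: assms(15) \<alpha>)
  have start: "nrm (x 0 - xstar) \<le> D"
  proof -
    have "x 1 = A (C (x 0)) (x 0)"
      using xS[of 0] q0 c by simp
    then show ?thesis
      using assms(12) dist_fixpoint_le_of_exact_step[OF nrm inv conv xX assms(4), of 0 D] by auto
  qed
  have bounds: "nrm (x k - xstar) \<le> \<alpha> ^ k * D \<and>
      infnorm (q k - c k) \<le> (\<alpha> - \<sigma>) / L\<^sub>A * \<alpha> ^ k * D" for k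
  proof (induction k)
    case 0
    show ?case
      using start q0 \<alpha>\<sigma> assms(5,11) by (simp add: infnorm_0)
  next
    case (Suc k)
    then have IHx: "nrm (x k - xstar) \<le> \<alpha> ^ k * D"
      and IHq: "infnorm (q k - c k) \<le> (\<alpha> - \<sigma>) / L\<^sub>A * \<alpha> ^ k * D"
      by auto
    have "nrm (x (Suc k) - xstar) \<le> L\<^sub>A * infnorm (q k - c k) + \<sigma> * nrm (x k - xstar)"
      using perturbed_step_error[OF nrm inv conv xX, of "q k" k] xS c by simp
    also have "\<dots> \<le> L\<^sub>A * ((\<alpha> - \<sigma>) / L\<^sub>A * \<alpha> ^ k * D) + \<sigma> * (\<alpha> ^ k * D)"
      using IHx IHq assms(3,5) by (intro add_mono mult_left_mono) auto
    also have "\<dots> = \<alpha> ^ Suc k * D"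
      using assms(5) by (simp add: field_simps)
    finally have x_bound: "nrm (x (Suc k) - xstar) \<le> \<alpha> ^ Suc k * D" .
    have "infnorm (c (Suc k) - q k) \<le> infnorm (c (Suc k) - c k) + infnorm (c k - q k)"
      using infnorm_triangle[of "c (Suc k) - c k" "c k - q k"] by simp
    also have "infnorm (c k - q k) = infnorm (q k - c k)"
      by (rule infnorm_sub)
    also have "infnorm (c (Suc k) - c k) \<le> L\<^sub>C * (nrm (x (Suc k) - xstar) + nrm (x k - xstar))"
      using output_change_le[OF nrm conv assms(6) xX xX] c by simp
    also have "\<dots> \<le> L\<^sub>C * (\<alpha> ^ Suc k * D + \<alpha> ^ k * D)"
      using x_bound IHx assms(6) by (intro mult_left_mono add_mono) auto
    also note IHq
    also have "L\<^sub>C * (\<alpha> ^ Suc k * D + \<alpha> ^ k * D) + (\<alpha> - \<sigma>) / L\<^sub>A * \<alpha> ^ k * D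
        = (L\<^sub>A * L\<^sub>C * (1 + \<alpha>) + (\<alpha> - \<sigma>)) * (\<alpha> ^ k * D / L\<^sub>A)"
      using assms(5) by (simp add: field_simps)
    also have "\<dots> \<le> K * \<alpha> * (\<alpha> ^ k * D / L\<^sub>A)"
      using quantization_range_suffices[OF _ KP K1 \<alpha>\<sigma>] \<alpha>0 assms(5,6,11,16)
      by (intro mult_right_mono) auto
    also have "\<dots> = r k"
      by (simp add: assms(15))
    finally have box: "\<bar>c (Suc k) $ i $ j - q k $ i $ j\<bar> \<le> r k" for i j
      by (simp add: infnorm_le_iff_components)
    have "infnorm (q (Suc k) - c (Suc k)) \<le> r k / (2 ^ b - 1)"
      using abs_quant_diff_le[OF rpos assms(8) box] by (simp add: infnorm_le_iff_components qS)
    then show ?case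
      using x_bound by (simp only: r_res)
  qed
  show ?thesis
  proof (intro conjI allI impI)
    fix k show "nrm (x k - xstar) \<le> \<alpha> ^ k * D" using bounds by blast
  next
    fix \<epsilon> :: real and k :: nat
    assume "0 < \<epsilon>" and "1 / (1 - \<alpha>) * ln (D / \<epsilon>) \<le> real k"
    then have "\<alpha> ^ k * D \<le> \<epsilon>"
      using \<alpha>0 assms(11,16) by (intro geometric_decay_le) auto
    then show "nrm (x k - xstar) \<le> \<epsilon>"
      using bounds[of k] by linarith
  qed
qed

end
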